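(* Let $\mathcal{A} \subseteq \mathbb{R}$ be a compact set and $\mu_0$ a Borel probability measure with topological support $\operatorname{supp}\mu_0 = \mathcal{A}$. Let $\Omega=\mathcal{A}^{\mathbb{Z}}$, $\mu=\mu_0^{\mathbb{Z}}$, and let $T:\Omega\to\Omega$ be the shift $[T\omega]_n = \omega_{n+1}$. If $\mathcal{A}$ is connected, then the Schwartzman group of $(\Omega,T,\mu)$ is $\mathfrak{S}(\Omega,T,\mu)=\mathbb{Z}$.
   Context: $\mathcal{A}$ carries the relative topology inherited from $\mathbb{R}$ and $\Omega=\mathcal{A}^{\mathbb{Z}}$ the product topology. Schwartzman group: Let $\Omega$ be a compact metric space, $T:\Omega\to\Omega$ a homeomorphism and $\mu$ a $T$-ergodic Borel probability measure. The suspension $(X,\tau,\nu)$ is given by $X=(\Omega\times\mathbb{R})/\!\sim$ with $(T^n\omega,t)\sim(\omega,t+n)$ for $\omega\in\Omega$, $t\in\mathbb{R}$, $n\in\mathbb{Z}$, the flow $\tau^s([\omega,t])=[\omega,s+t]$, and the measure $\int_X f\,d\nu=\int_\Omega\int_0^1 f([\omega,t])\,dt\,d\mu(\omega)$. Let $\mathbb{T}=\mathbb{R}/\mathbb{Z}$. Given continuous $\phi:X\to\mathbb{T}$ and $x\in X$, let $\widetilde\phi_x:\mathbb{R}\to\mathbb{R}$ be a continuous lift of $\phi_x(t)=\phi(\tau^t x)$, i.e. $\widetilde\phi_x \bmod \mathbb{Z}=\phi_x$. The limit $\lim_{t\to\infty}\widetilde\phi_x(t)/t$ exists for $\nu$-a.e.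 $x$, is $\nu$-a.e. constant, and depends only on the homotopy class of $\phi$. Denote by $C^\sharp(X,\mathbb{T})$ the set of homotopy classes of continuous maps $X\to\mathbb{T}$ and by $\mathfrak{A}_\nu:C^\sharp(X,\mathbb{T})\to\mathbb{R}$ the induced map (the Schwartzman homomorphism). The Schwartzman group is $\mathfrak{S}(\Omega,T,\mu)=\mathfrak{A}_\nu(C^\sharp(X,\mathbb{T}))$. *)

theory Defs
  imports "HOL-Probability.Probability"
begin

definition quotient_topology :: "'a topology \<Rightarrow> 'a rel \<Rightarrow> 'a set topology" where
  "quotient_topology X r =
     topology (\<lambda>U. U \<subseteq> topspace X // r \<and> openin X {x \<in> topspace X. r `` {x} \<in> U})"

lemma openin_quotient_topology:
  "openin (quotient_topology X r) U \<longleftrightarrow>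
     U \<subseteq> topspace X // r \<and> openin X {x \<in> topspace X. r `` {x} \<in> U}"
proof -
  have "istopology (\<lambda>U. U \<subseteq> topspace X // r \<and> openin X {x \<in> topspace X. r `` {x} \<in> U})"
    unfolding istopology_def
  proof (intro conjI allI impI)
    fix S T
    assume S: "S \<subseteq> topspace X // r \<and> openin X {x \<in> topspace X. r `` {x} \<in> S}"
      and T: "T \<subseteq> topspace X // r \<and> openin X {x \<in> topspace X. r `` {x} \<in> T}"
    show "S \<inter> T \<subseteq> topspace X // r" using S by blast
    have "{x \<in> topspace X. r `` {x} \<in> S \<inter> T}
        = {x \<in> topspace X. r `` {x} \<in> S} \<inter> {x \<in> topspace X. r `` {x} \<in> T}" by blast
    then show "openin X {x \<in> topspace X. r `` {x} \<in> S \<inter> T}"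
      using S T by (simp add: openin_Int)
  next
    fix K
    assume K: "\<forall>S\<in>K. S \<subseteq> topspace X // r \<and> openin X {x \<in> topspace X. r `` {x} \<in> S}"
    then show "\<Union>K \<subseteq> topspace X // r" by blast
    have "{x \<in> topspace X. r `` {x} \<in> \<Union>K} = (\<Union>S\<in>K. {x \<in> topspace X. r `` {x} \<in> S})"
      by blast
    then show "openin X {x \<in> topspace X. r `` {x} \<in> \<Union>K}"
      using K by (metis (no_types, lifting) imageE openin_Union)
  qed
  then show ?thesis
    by (simp add: quotient_topology_def)
qed

lemma topspace_quotient_topology: "topspace (quotient_topology X r) = topspace X // r"
proof
  show "topspace (quotient_topology X r) \<subseteq> topspace X // r"
    by (meson openin_quotient_topology openin_topspace)
  have "{x \<in> topspace X. r `` {x} \<in> topspace X // r} = topspace X"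
    by (auto intro: quotientI)
  then have "openin (quotient_topology X r) (topspace X // r)"
    by (simp add: openin_quotient_topology)
  then show "topspace X // r \<subseteq> topspace (quotient_topology X r)"
    by (rule openin_subset)
qed

lemma quotient_map_quotient_topology:
  "quotient_map X (quotient_topology X r) (\<lambda>x. r `` {x})"
  unfolding quotient_map_def topspace_quotient_topology openin_quotient_topology
  by (auto simp: quotient_def)

definition mod_Ints :: "real rel" where
  "mod_Ints = {(x, y). x - y \<in> \<int>}"

definition RmodZ :: "real set topology" where
  "RmodZ = quotient_topology euclideanreal mod_Ints"

text \<open>
  Below, \<open>\<Omega>\<close> is meant to be a compact metrizable topology, \<open>T\<close> a homeomorphism of \<open>\<Omega>\<close> onto itself
  (whose values off \<open>topspace \<Omega>\<close> play no role), and \<open>\<mu>\<close> a \<open>T\<close>-ergodic probability measure on the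
  Borel sets of \<open>\<Omega>\<close>.
\<close>

definition int_iterate :: "'a topology \<Rightarrow> ('a \<Rightarrow> 'a) \<Rightarrow> int \<Rightarrow> 'a \<Rightarrow> 'a" where
  "int_iterate \<Omega> T n =
     (if 0 \<le> n then T ^^ nat n else inv_into (topspace \<Omega>) T ^^ nat (- n))"

definition suspension_rel :: "'a topology \<Rightarrow> ('a \<Rightarrow> 'a) \<Rightarrow> ('a \<times> real) rel" where
  "suspension_rel \<Omega> T =
     {((int_iterate \<Omega> T n \<omega>, t), (\<omega>, t + of_int n)) | \<omega> t n. \<omega> \<in> topspace \<Omega>}"

definition suspension :: "'a topology \<Rightarrow> ('a \<Rightarrow> 'a) \<Rightarrow> ('a \<times> real) set topology" where
  "suspension \<Omega> T = quotient_topology (prod_topology \<Omega> euclideanreal) (suspension_rel \<Omega> T)"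

text \<open>
  The translate of the equivalence class of \<open>(\<omega>, t)\<close> is exactly the class of \<open>(\<omega>, s + t)\<close>, so the
  induced flow is the elementwise image.
\<close>

definition suspension_flow :: "real \<Rightarrow> ('a \<times> real) set \<Rightarrow> ('a \<times> real) set" where
  "suspension_flow s x = (\<lambda>(\<omega>, t). (\<omega>, s + t)) ` x"

text \<open>
  The measure with \<open>\<integral> f d\<nu> = \<integral>\<^sub>\<Omega> \<integral>\<^sub>0\<^sup>1 f [\<omega>, t] dt d\<mu>\<close>, on the Borel sets of the suspension: the image of
  \<open>\<mu> \<otimes> Lebesgue\<close> under \<open>(\<omega>, t) \<mapsto> [\<omega>, t]\<close>.
\<close>

definition suspension_measure ::
    "'a topology \<Rightarrow> ('a \<Rightarrow> 'a) \<Rightarrow> 'a measure \<Rightarrow> ('a \<times> real) set measure" where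
  "suspension_measure \<Omega> T \<mu> =
     distr (\<mu> \<Otimes>\<^sub>M restrict_space lborel {0..1})
           (sigma (topspace (suspension \<Omega> T)) {U. openin (suspension \<Omega> T) U})
           (\<lambda>p. suspension_rel \<Omega> T `` {p})"

definition is_lift_along_flow ::
    "(('a \<times> real) set \<Rightarrow> real set) \<Rightarrow> ('a \<times> real) set \<Rightarrow> (real \<Rightarrow> real) \<Rightarrow> bool" where
  "is_lift_along_flow \<phi> x g \<longleftrightarrow>
     continuous_on UNIV g \<and> (\<forall>t. mod_Ints `` {g t} = \<phi> (suspension_flow t x))"

text \<open>
  Lifts exist for continuous \<open>\<phi>\<close> and differ by integer constants, so the limit of \<open>g t / t\<close> does not
  depend on the lift \<open>g\<close>.
\<close>

definition rotation_number ::
    "'a topology \<Rightarrow> ('a \<Rightarrow> 'a) \<Rightarrow> 'a measure \<Rightarrow> (('a \<times> real) set \<Rightarrow> real set) \<Rightarrow> real" where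
  "rotation_number \<Omega> T \<mu> \<phi> =
     (THE c. AE x in suspension_measure \<Omega> T \<mu>.
        \<exists>g. is_lift_along_flow \<phi> x g \<and> ((\<lambda>t. g t / t) \<longlongrightarrow> c) at_top)"

definition homotopy_classes :: "'a topology \<Rightarrow> 'b topology \<Rightarrow> ('a \<Rightarrow> 'b) set set" where
  "homotopy_classes X Y =
     {f. continuous_map X Y f} // {(f, g). homotopic_with (\<lambda>_. True) X Y f g}"

text \<open>
  The rotation number is constant on each homotopy class, so \<^const>\<open>the_elem\<close> yields the induced map.
\<close>

definition schwartzman_hom ::
    "'a topology \<Rightarrow> ('a \<Rightarrow> 'a) \<Rightarrow> 'a measure \<Rightarrow> (('a \<times> real) set \<Rightarrow> real set) set \<Rightarrow> real" where
  "schwartzman_hom \<Omega> T \<mu> C = the_elem (rotation_number \<Omega> T \<mu> ` C)"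

definition schwartzman_group :: "'a topology \<Rightarrow> ('a \<Rightarrow> 'a) \<Rightarrow> 'a measure \<Rightarrow> real set" where
  "schwartzman_group \<Omega> T \<mu> =
     schwartzman_hom \<Omega> T \<mu> ` homotopy_classes (suspension \<Omega> T) RmodZ"

definition topological_support :: "'a::topological_space measure \<Rightarrow> 'a set" where
  "topological_support M = {x. \<forall>U. open U \<and> x \<in> U \<longrightarrow> 0 < emeasure M U}"

definition full_shift :: "real set \<Rightarrow> (int \<Rightarrow> real) topology" where
  "full_shift A = product_topology (\<lambda>_. top_of_set A) UNIV"

definition shift_map :: "(int \<Rightarrow> 'a) \<Rightarrow> int \<Rightarrow> 'a" where
  "shift_map \<omega> = (\<lambda>n. \<omega> (n + 1))"

text \<open>
  The measure \<open>\<mu>\<^sub>0\<close> lives on the real line; when its support is \<open>A\<close> the restriction to \<open>A\<close> is again a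
  probability measure, and the product is a measure on \<open>topspace (full_shift A)\<close>.
\<close>

definition product_shift_measure :: "real set \<Rightarrow> real measure \<Rightarrow> (int \<Rightarrow> real) measure" where
  "product_shift_measure A \<mu>\<^sub>0 = PiM UNIV (\<lambda>_. restrict_space \<mu>\<^sub>0 A)"

end

theory Submission
  imports Defs
begin

text \<open>
  A nonempty compact connected set \<open>A\<close> of reals is convex, so the sequence space over \<open>A\<close> is convex, and
  the shift acts on it by affine maps. A constant sequence \<open>c\<close> is a fixed point of the shift. Hence
  \<open>(s, [\<omega>, t]) \<mapsto> [(1 - s) c + s \<omega>, t]\<close> is compatible with the identifications of the suspension and
  deforms it to the closed orbit \<open>{[c, t] | t}\<close>, which is a circle of length one. A
  circle-valued map on the suspension therefore behaves, up to homotopy, like a circle-valued map of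
  period one on the line, and the rotation number of the latter is its integer degree.
  
  What turns this picture into a proof is that homotopic maps have lifts at bounded distance along each
  orbit (\<open>homotopic_circle_lifts_bounded_distance\<close>): by compactness the homotopy parameter can be cut
  into finitely many steps, the same number at every point, during each of which the value moves by
  less than half a turn. Bounded distance does not change the limit of \<open>g t / t\<close>. Used for the
  deformation above, this shows that every lift along every orbit has slope the degree of the map on the
  orbit of \<open>c\<close> (\<open>lifts_along_suspension_flow\<close>); used for an arbitrary homotopy, it shows that the slope
  depends on the homotopy class only (\<open>homotopic_imp_rotation_slopes_eq\<close>). Since the slope is the same
  on all orbits, the measure enters only through the fact that it is not zero, which makes the
  almost sure limit unique. This needs the quotient map to be measurable, which is where second
  countability comes in. Finally, the maps \<open>[\<omega>, t] \<mapsto> k t\<close> realise every integer \<open>k\<close>.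
\<close>

section \<open>Lifts of circle-valued maps\<close>

lemma cis_2pi_eq_iff: "cis (2 * pi * a) = cis (2 * pi * b) \<longleftrightarrow> a - b \<in> \<int>"
proof -
  have "cis (2 * pi * a) = cis (2 * pi * b) \<longleftrightarrow> exp (\<i> * of_real (2 * pi * (a - b))) = 1"
    by (simp add: cis_conv_exp right_diff_distrib exp_diff)
  also have "\<dots> \<longleftrightarrow> (\<exists>n::int. 2 * pi * (a - b) = of_int (2 * n) * pi)"
    by (simp add: exp_eq_1)
  also have "\<dots> \<longleftrightarrow> (\<exists>n::int. a - b = of_int n)"
    by (intro ex_cong1) auto
  also have "\<dots> \<longleftrightarrow> a - b \<in> \<int>"
    by (auto simp: Ints_def)
  finally show ?thesis .
qed

lemma Ints_valued_continuous_constant: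
  fixes f :: "'a::topological_space \<Rightarrow> real"
  assumes "connected S" "continuous_on S f" "\<And>x. x \<in> S \<Longrightarrow> f x \<in> \<int>"
  shows "f constant_on S"
proof (rule continuous_discrete_range_constant [OF assms(1,2)])
  fix x assume "x \<in> S"
  have "1 \<le> norm (f y - f x)" if "y \<in> S" "f y \<noteq> f x" for y
    using that assms(3)[OF \<open>x \<in> S\<close>] assms(3)[OF \<open>y \<in> S\<close>]
    by (metis Ints_diff Ints_nonzero_abs_ge1 eq_iff_diff_eq_0 real_norm_def)
  then show "\<exists>e>0. \<forall>y. y \<in> S \<and> f y \<noteq> f x \<longrightarrow> e \<le> norm (f y - f x)"
    by (intro exI[of _ 1]) auto
qed

lemma circle_lifts_differ_by_constant:
  fixes f g :: "'a::topological_space \<Rightarrow> real"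
  assumes "connected S" "continuous_on S f" "continuous_on S g"
    and "\<And>x. x \<in> S \<Longrightarrow> cis (2 * pi * f x) = cis (2 * pi * g x)"
  shows "\<exists>c\<in>\<int>. \<forall>x\<in>S. f x = g x + c"
proof -
  have int: "f x - g x \<in> \<int>" if "x \<in> S" for x
    using assms(4)[OF that] cis_2pi_eq_iff by blast
  have "(\<lambda>x. f x - g x) constant_on S"
    using assms int by (intro Ints_valued_continuous_constant continuous_intros)
  then obtain c where c: "\<And>x. x \<in> S \<Longrightarrow> f x - g x = c"
    by (auto simp: constant_on_def)
  show ?thesis
  proof (cases "S = {}")
    case False
    then show ?thesis using c int by (metis add.commute diff_add_cancel ex_in_conv)
  qed auto
qed

lemma circle_lift_on_contractible:
  fixes f :: "'a::real_normed_vector \<Rightarrow> complex"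
  assumes "continuous_on S f" "contractible S" "\<And>x. x \<in> S \<Longrightarrow> norm (f x) = 1"
  obtains g where "continuous_on S g" "\<And>x. x \<in> S \<Longrightarrow> cis (2 * pi * g x) = f x"
proof -
  have "\<And>x. x \<in> S \<Longrightarrow> f x \<noteq> 0" using assms(3) by force
  then obtain h where h: "continuous_on S h" "\<And>x. x \<in> S \<Longrightarrow> f x = exp (h x)"
    using continuous_logarithm_on_contractible[OF assms(1,2)] by blast
  have "Re (h x) = 0" if "x \<in> S" for x
    using assms(3)[OF that] h(2)[OF that] by simp
  then have "cis (2 * pi * (Im (h x) / (2 * pi))) = f x" if "x \<in> S" for x
    using that h(2) by (simp add: exp_eq_polar)
  moreover have "continuous_on S (\<lambda>x. Im (h x) / (2 * pi))"
    using h(1) by (intro continuous_intros) auto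
  ultimately show thesis using that by blast
qed

text \<open>
  A lift that changes by more than half a turn passes, by the intermediate value theorem, through a
  point at exactly half a turn from its start. There the circle value is antipodal to the initial
  one, that is, at distance 2.
\<close>

lemma circle_lift_step:
  fixes l :: "real \<Rightarrow> real"
  assumes "a \<le> b" "continuous_on {a..b} l"
    and near: "\<And>x. x \<in> {a..b} \<Longrightarrow> dist (cis (2 * pi * l x)) (cis (2 * pi * l a)) < 2"
  shows "\<bar>l b - l a\<bar> \<le> 1/2"
proof (rule ccontr)
  assume "\<not> ?thesis"
  then have far: "\<bar>l b - l a\<bar> > 1/2" by simp
  have "\<exists>x\<ge>a. x \<le> b \<and> \<bar>l x - l a\<bar> = 1/2"
    using far assms(1) by (intro IVT') (auto intro!: continuous_intros assms(2))
  then obtain x where x: "x \<in> {a..b}" "\<bar>l x - l a\<bar> = 1/2" by auto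
  have "cis (2 * pi * l x) = - cis (2 * pi * l a)"
  proof -
    consider "l x = l a + 1/2" | "l a = l x + 1/2" using x(2) by linarith
    then show ?thesis
    proof cases
      case 1
      then have "2 * pi * l x = 2 * pi * l a + pi" by (simp add: distrib_left)
      then show ?thesis by (simp add: minus_cis)
    next
      case 2
      then have "2 * pi * l a = 2 * pi * l x + pi" by (simp add: distrib_left)
      then show ?thesis by (metis minus_cis minus_minus)
    qed
  qed
  then have "dist (cis (2 * pi * l x)) (cis (2 * pi * l a)) = norm (2 * cis (2 * pi * l a))"
    by (simp add: dist_norm flip: norm_minus_cancel[of "- 2 * _"])
  then show False using near[OF x(1)] by (simp add: norm_mult)
qed

text \<open>
  Uniform continuity gives a subdivision of the unit interval into \<open>N\<close> steps that is fine enough for all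
  parameters in \<open>K\<close> at once, and each step contributes at most half a turn.
\<close>

lemma circle_lift_variation_bounded:
  fixes H :: "real \<times> 'p::metric_space \<Rightarrow> complex"
  assumes "compact K" "continuous_on ({0..1} \<times> K) H"
  obtains M where "\<And>p l. \<lbrakk>p \<in> K; continuous_on {0..1} l;
      \<And>s. s \<in> {0..1} \<Longrightarrow> cis (2 * pi * l s) = H (s, p)\<rbrakk> \<Longrightarrow> \<bar>l 1 - l 0\<bar> \<le> M"
proof -
  have "uniformly_continuous_on ({0..1} \<times> K) H"
    using assms by (intro compact_uniformly_continuous compact_Times) auto
  then have "\<exists>d>0. \<forall>y\<in>{0..1} \<times> K. \<forall>x\<in>{0..1} \<times> K. dist x y < d \<longrightarrow> dist (H x) (H y) < 2"
    unfolding uniformly_continuous_on_def by (metis dist_commute zero_less_numeral)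
  then obtain d where d: "d > 0"
    "\<And>x y. \<lbrakk>x \<in> {0..1} \<times> K; y \<in> {0..1} \<times> K; dist x y < d\<rbrakk> \<Longrightarrow> dist (H x) (H y) < 2"
    by blast
  obtain N where N: "N > 0" "inverse (real N) < d"
    using d(1) ex_inverse_of_nat_less by blast
  show thesis
  proof (rule that[of "real N / 2"])
    fix p l
    assume p: "p \<in> K" and cont: "continuous_on {0..1} l"
      and l: "\<And>s. s \<in> {0..1} \<Longrightarrow> cis (2 * pi * l s) = H (s, p)"
    have step: "\<bar>l (real (Suc j) / real N) - l (real j / real N)\<bar> \<le> 1/2" if "j < N" for j
    proof (rule circle_lift_step[of _ _ l])
      have sub: "{real j / real N..real (Suc j) / real N} \<subseteq> {0..1}"
        using that N by (auto simp: field_simps)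
      show "real j / real N \<le> real (Suc j) / real N" using N by (simp add: divide_simps)
      show "continuous_on {real j / real N..real (Suc j) / real N} l"
        using cont sub continuous_on_subset by blast
      fix x assume x: "x \<in> {real j / real N..real (Suc j) / real N}"
      have "\<bar>x - real j / real N\<bar> < d"
        using x N by (auto simp: field_simps)
      then have "dist (x, p) (real j / real N, p) < d"
        by (simp add: dist_Pair_Pair dist_real_def)
      moreover have "real j / real N \<in> {0..1}" "x \<in> {0..1}"
        using subsetD[OF sub x] that N by auto
      ultimately show "dist (cis (2 * pi * l x)) (cis (2 * pi * l (real j / real N))) < 2"
        using d(2) p l by simp
    qed
    have "\<bar>l (real j / real N) - l 0\<bar> \<le> real j / 2" if "j \<le> N" for j
      using that
    proof (induction j)
      case (Suc j)
      define x y where "x = l (real (Suc j) / real N)" and "y = l (real j / real N)"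
      have "\<bar>x - y\<bar> \<le> 1/2" "\<bar>y - l 0\<bar> \<le> real j / 2"
        using Suc step[of j] by (auto simp: x_def y_def)
      then have "\<bar>x - l 0\<bar> \<le> real (Suc j) / 2"
        using abs_triangle_ineq[of "x - y" "y - l 0"] by simp
      then show ?case by (simp add: x_def)
    qed simp
    from this[of N] show "\<bar>l 1 - l 0\<bar> \<le> real N / 2" using N by simp
  qed
qed

text \<open>
  The second coordinate stands for a point of the suspended space and the last one for time. The line
  is not compact, so the bound comes from a return to the fundamental domain \<open>S \<times> {0..1}\<close>: the
  homotopy at any time coincides, as a path in \<open>s\<close>, with the one at a point of this domain. Lifting
  over the strip \<open>[0,1] \<times> \<real>\<close> connects a lift at \<open>s = 0\<close> with a lift at \<open>s = 1\<close>.
\<close>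

lemma homotopic_circle_lifts_bounded_distance:
  fixes H :: "real \<times> 'a::metric_space \<times> real \<Rightarrow> complex" and g\<^sub>0 g\<^sub>1 :: "real \<Rightarrow> real"
  assumes "compact S" "continuous_on ({0..1} \<times> S \<times> UNIV) H"
    and unit: "\<And>z. z \<in> {0..1} \<times> S \<times> UNIV \<Longrightarrow> norm (H z) = 1"
    and reduce: "\<And>w t. w \<in> S \<Longrightarrow> \<exists>v\<in>S. \<exists>r\<in>{0..1}. \<forall>s\<in>{0..1}. H (s, w, t) = H (s, v, r)"
    and w: "w \<in> S"
    and g0: "continuous_on UNIV g\<^sub>0" "\<And>t. cis (2 * pi * g\<^sub>0 t) = H (0, w, t)"
    and g1: "continuous_on UNIV g\<^sub>1" "\<And>t. cis (2 * pi * g\<^sub>1 t) = H (1, w, t)"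
  obtains C where "\<And>t. \<bar>g\<^sub>1 t - g\<^sub>0 t\<bar> \<le> C"
proof -
  have "continuous_on ({0..1} \<times> (S \<times> {0..1})) H"
    using assms(2) by (rule continuous_on_subset) auto
  moreover have "compact (S \<times> {0..1::real})" using assms(1) by (intro compact_Times) auto
  ultimately obtain M where M: "\<And>p l. \<lbrakk>p \<in> S \<times> {0..1}; continuous_on {0..1} l;
      \<And>s. s \<in> {0..1} \<Longrightarrow> cis (2 * pi * l s) = H (s, p)\<rbrakk> \<Longrightarrow> \<bar>l 1 - l 0\<bar> \<le> M"
    using circle_lift_variation_bounded[of "S \<times> {0..1::real}" H] by blast
  let ?R = "{0..1::real} \<times> (UNIV :: real set)"
  have "continuous_on ?R (\<lambda>z. H (fst z, w, snd z))"
    using w by (intro continuous_on_compose2[OF assms(2)] continuous_intros) auto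
  moreover have "contractible ?R"
    by (intro convex_imp_contractible convex_Times) auto
  moreover have "norm (H (fst z, w, snd z)) = 1" if "z \<in> ?R" for z
    using that w by (intro unit) auto
  ultimately obtain L where L: "continuous_on ?R L"
      "\<And>z. z \<in> ?R \<Longrightarrow> cis (2 * pi * L z) = H (fst z, w, snd z)"
    using circle_lift_on_contractible[of ?R "\<lambda>z. H (fst z, w, snd z)"] by blast
  have LM: "\<bar>L (1, t) - L (0, t)\<bar> \<le> M" for t
  proof -
    obtain v r where v: "v \<in> S" "r \<in> {0..1}" "\<And>s. s \<in> {0..1} \<Longrightarrow> H (s, w, t) = H (s, v, r)"
      using reduce[OF w] by blast
    have "continuous_on {0..1} (\<lambda>s. L (s, t))"
      by (intro continuous_on_compose2[OF L(1)] continuous_intros) auto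
    then show ?thesis
      using M[of "(v, r)" "\<lambda>s. L (s, t)"] v L(2) by auto
  qed
  have slice: "continuous_on UNIV (\<lambda>t. L (s, t))" if "s \<in> {0..1}" for s
    using that by (intro continuous_on_compose2[OF L(1)] continuous_intros) auto
  have "\<exists>c\<in>\<int>. \<forall>t\<in>UNIV. g\<^sub>0 t = L (0, t) + c"
    using g0 L(2) by (intro circle_lifts_differ_by_constant slice connected_UNIV) auto
  then obtain c0 where c0: "\<And>t. g\<^sub>0 t = L (0, t) + c0" by blast
  have "\<exists>c\<in>\<int>. \<forall>t\<in>UNIV. g\<^sub>1 t = L (1, t) + c"
    using g1 L(2) by (intro circle_lifts_differ_by_constant slice connected_UNIV) auto
  then obtain c1 where c1: "\<And>t. g\<^sub>1 t = L (1, t) + c1" by blast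
  have "\<bar>g\<^sub>1 t - g\<^sub>0 t\<bar> \<le> M + \<bar>c1\<bar> + \<bar>c0\<bar>" for t
    using LM[of t] c0[of t] c1[of t] by linarith
  then show thesis using that by blast
qed

text \<open>
  The increment of the lift over one period is a continuous integer-valued function, hence a constant
  \<open>m\<close>, the degree; subtracting \<open>m * t\<close> leaves a periodic continuous, hence bounded, function.
\<close>

lemma periodic_circle_lift_linear:
  fixes g :: "real \<Rightarrow> real"
  assumes "continuous_on UNIV g" "\<And>t. cis (2 * pi * g (t + 1)) = cis (2 * pi * g t)"
  obtains m C where "m \<in> \<int>" "\<And>t. \<bar>g t - m * t\<bar> \<le> C"
proof -
  have "continuous_on UNIV (\<lambda>t. g (t + 1))"
    by (intro continuous_on_compose2[OF assms(1)] continuous_intros) auto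
  then have "\<exists>m\<in>\<int>. \<forall>t\<in>UNIV. g (t + 1) = g t + m"
    using assms by (intro circle_lifts_differ_by_constant connected_UNIV) auto
  then obtain m where m: "m \<in> \<int>" "\<And>t. g (t + 1) = g t + m" by blast
  define h where "h t = g t - m * t" for t
  have per: "h (t + 1) = h t" for t using m(2)[of t] by (simp add: h_def algebra_simps)
  have pern: "h (t + of_int n) = h t" for t n
  proof (induction n rule: int_induct[of _ 0])
    case (step1 i) then show ?case using per[of "t + of_int i"] by (simp add: algebra_simps)
  next
    case (step2 i) then show ?case using per[of "t + of_int i - 1"] by (simp add: algebra_simps)
  qed simp
  have "continuous_on {0..1} h"
    unfolding h_def by (intro continuous_intros continuous_on_subset[OF assms(1)]) auto
  then have "bounded (h ` {0..1})"
    by (intro compact_imp_bounded compact_continuous_image) auto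
  then obtain C where C: "\<And>r. r \<in> {0..1} \<Longrightarrow> \<bar>h r\<bar> \<le> C"
    unfolding bounded_iff real_norm_def by blast
  have "\<bar>g t - m * t\<bar> \<le> C" for t
  proof -
    have "h t = h (frac t)" using pern[of "frac t" "\<lfloor>t\<rfloor>"] by (simp add: frac_def)
    moreover have "frac t \<in> {0..1}" using frac_lt_1[of t] by (simp add: less_imp_le)
    ultimately show ?thesis using C[of "frac t"] by (simp add: h_def)
  qed
  then show thesis using that m by blast
qed

lemma slope_of_bounded_distance:
  fixes g :: "real \<Rightarrow> real"
  assumes "\<And>t. \<bar>g t - m * t\<bar> \<le> C"
  shows "((\<lambda>t. g t / t) \<longlongrightarrow> m) at_top"
proof -
  have "((\<lambda>t. C / t) \<longlongrightarrow> 0) at_top"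
    by (intro tendsto_divide_0[OF tendsto_const] filterlim_at_top_imp_at_infinity filterlim_ident)
  then have "((\<lambda>t. g t / t - m) \<longlongrightarrow> 0) at_top"
  proof (rule Lim_null_comparison[rotated])
    show "\<forall>\<^sub>F t in at_top. norm (g t / t - m) \<le> C / t"
      using eventually_gt_at_top[of 0]
    proof eventually_elim
      case (elim t)
      then have "g t / t - m = (g t - m * t) / t" by (simp add: field_simps)
      then show ?case using elim assms[of t] by (simp add: abs_divide divide_right_mono)
    qed
  qed
  then show ?thesis by (simp add: LIM_zero_iff)
qed

section \<open>The circle as a quotient of the line\<close>

text \<open>
  The identification of the real line modulo the integers with the unit circle in the complex plane. All
  representatives of a class have the same image, so the image of a class is a singleton.
\<close>

definition to_circle :: "real set \<Rightarrow> complex" where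
  "to_circle c = the_elem ((\<lambda>r. cis (2 * pi * r)) ` c)"

lemma to_circle_class [simp]: "to_circle (mod_Ints `` {r}) = cis (2 * pi * r)"
proof -
  have "(\<lambda>r. cis (2 * pi * r)) ` (mod_Ints `` {r}) = {cis (2 * pi * r)}"
  proof
    show "(\<lambda>r. cis (2 * pi * r)) ` (mod_Ints `` {r}) \<subseteq> {cis (2 * pi * r)}"
      by (auto simp: mod_Ints_def) (metis cis_2pi_eq_iff)
    have "r \<in> mod_Ints `` {r}" by (simp add: mod_Ints_def)
    then show "{cis (2 * pi * r)} \<subseteq> (\<lambda>r. cis (2 * pi * r)) ` (mod_Ints `` {r})" by blast
  qed
  then show ?thesis by (simp add: to_circle_def)
qed

lemma mod_Ints_class_eq_iff: "mod_Ints `` {r} = mod_Ints `` {s} \<longleftrightarrow> r - s \<in> \<int>"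
proof
  assume "mod_Ints `` {r} = mod_Ints `` {s}"
  then show "r - s \<in> \<int>" by (metis to_circle_class cis_2pi_eq_iff)
next
  assume rs: "r - s \<in> \<int>"
  have "r - y \<in> \<int> \<longleftrightarrow> s - y \<in> \<int>" for y
    using Ints_add[OF rs, of "s - y"] Ints_diff[OF _ rs, of "r - y"] by auto
  then show "mod_Ints `` {r} = mod_Ints `` {s}" by (auto simp: mod_Ints_def)
qed

lemma topspace_RmodZ: "topspace RmodZ = range (\<lambda>r. mod_Ints `` {r})"
  by (auto simp: RmodZ_def topspace_quotient_topology quotient_def)

lemma class_eq_iff_to_circle:
  assumes "c \<in> topspace RmodZ"
  shows "mod_Ints `` {r} = c \<longleftrightarrow> cis (2 * pi * r) = to_circle c"
proof -
  obtain s where "c = mod_Ints `` {s}" using assms by (auto simp: topspace_RmodZ)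
  then show ?thesis by (simp only: mod_Ints_class_eq_iff cis_2pi_eq_iff to_circle_class)
qed

lemma norm_to_circle: "c \<in> topspace RmodZ \<Longrightarrow> norm (to_circle c) = 1"
  by (auto simp: topspace_RmodZ)

lemma continuous_map_to_circle: "continuous_map RmodZ euclidean to_circle"
  unfolding RmodZ_def
proof (rule continuous_compose_quotient_map[OF quotient_map_quotient_topology])
  have "to_circle \<circ> (\<lambda>x. mod_Ints `` {x}) = (\<lambda>r. cis (2 * pi * r))" by auto
  then show "continuous_map euclideanreal euclidean (to_circle \<circ> (\<lambda>x. mod_Ints `` {x}))"
    by (auto intro!: continuous_intros)
qed

section \<open>The suspension of the full shift\<close>

definition sequences_in :: "real set \<Rightarrow> (int \<Rightarrow> real) set" where
  "sequences_in A = {\<omega>. \<forall>n. \<omega> n \<in> A}"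

lemma PiE_UNIV_eq_sequences_in: "(\<Pi>\<^sub>E n\<in>UNIV. A) = sequences_in A"
  by (auto simp: sequences_in_def PiE_iff extensional_def)

lemma full_shift_eq: "full_shift A = top_of_set (sequences_in A)"
proof -
  have "full_shift A = subtopology (product_topology (\<lambda>_. euclidean) UNIV) (\<Pi>\<^sub>E n\<in>UNIV. A)"
    unfolding full_shift_def by (rule subtopology_product_topology[symmetric])
  then show ?thesis by (simp add: euclidean_product_topology PiE_UNIV_eq_sequences_in)
qed

lemma compact_sequences_in:
  assumes "compact A" shows "compact (sequences_in A)"
proof -
  have "compact_space (full_shift A)"
    using assms by (simp add: full_shift_def compact_space_product_topology compact_space_subtopology compactin_euclidean_iff)
  then show ?thesis
    unfolding full_shift_eq by (metis compact_space_subtopology compactin_euclidean_iff compactin_subtopology compact_space_def topspace_euclidean_subtopology)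
qed

lemma prod_full_shift: "prod_topology (full_shift A) euclideanreal = top_of_set (sequences_in A \<times> UNIV)"
  unfolding full_shift_eq by (metis prod_topology_subtopology_eu subtopology_UNIV)

definition translate :: "int \<Rightarrow> (int \<Rightarrow> 'a) \<Rightarrow> int \<Rightarrow> 'a" where
  "translate n \<omega> = (\<lambda>m. \<omega> (m + n))"

lemma translate_0 [simp]: "translate 0 \<omega> = \<omega>"
  by (simp add: translate_def)

lemma translate_translate [simp]: "translate m (translate n \<omega>) = translate (m + n) \<omega>"
  by (simp add: translate_def add.assoc)

lemma translate_in_sequences [simp]: "translate n \<omega> \<in> sequences_in A \<longleftrightarrow> \<omega> \<in> sequences_in A"
  unfolding sequences_in_def translate_def by (auto) (metis diff_add_cancel)

lemma shift_map_eq_translate: "shift_map = translate 1"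
  by (simp add: shift_map_def translate_def fun_eq_iff)

lemma int_iterate_shift:
  assumes "\<omega> \<in> sequences_in A"
  shows "int_iterate (full_shift A) shift_map n \<omega> = translate n \<omega>"
proof -
  have pos: "(shift_map ^^ k) \<omega> = translate (int k) \<omega>" for k
    by (induction k) (simp_all add: shift_map_eq_translate)
  have "inj_on shift_map (sequences_in A)"
    by (rule inj_on_inverseI[of _ "translate (-1)"]) (simp add: shift_map_eq_translate)
  then have inv: "inv_into (sequences_in A) shift_map \<alpha> = translate (-1) \<alpha>"
    if "\<alpha> \<in> sequences_in A" for \<alpha>
    using that by (intro inv_into_f_eq) (auto simp: shift_map_eq_translate)
  have neg: "(inv_into (sequences_in A) shift_map ^^ k) \<omega> = translate (- int k) \<omega>" for k
    by (induction k) (simp_all add: inv assms)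
  show ?thesis
    by (simp add: int_iterate_def pos neg full_shift_eq)
qed

definition suspension_point :: "real set \<Rightarrow> (int \<Rightarrow> real) \<times> real \<Rightarrow> ((int \<Rightarrow> real) \<times> real) set" where
  "suspension_point A p = suspension_rel (full_shift A) shift_map `` {p}"

text \<open>
  Since the shift is invertible, a class can be parametrised by the integers. This makes the flow, the
  identifications and functions defined on representatives explicit.
\<close>

lemma suspension_point_eq_orbit:
  assumes "\<omega> \<in> sequences_in A"
  shows "suspension_point A (\<omega>, t) = range (\<lambda>n. (translate n \<omega>, t - of_int n))"
proof -
  have "((\<omega>, t), (\<alpha>, r)) \<in> suspension_rel (full_shift A) shift_map \<longleftrightarrow>
      (\<exists>n. \<alpha> = translate n \<omega> \<and> r = t - of_int n)" (is "?L \<longleftrightarrow> ?R") for \<alpha> r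
  proof
    assume ?L
    then obtain n where n: "\<alpha> \<in> sequences_in A" "\<omega> = int_iterate (full_shift A) shift_map n \<alpha>" "r = t + of_int n"
      by (auto simp: suspension_rel_def full_shift_eq)
    then have "\<alpha> = translate (- n) \<omega>" by (simp add: int_iterate_shift)
    then show ?R using n(3) by (intro exI[of _ "- n"]) simp
  next
    assume ?R
    then obtain n where n: "\<alpha> = translate n \<omega>" "r = t - of_int n" by blast
    have "\<alpha> \<in> sequences_in A" "\<omega> = int_iterate (full_shift A) shift_map (- n) \<alpha>"
      using assms by (simp_all add: n int_iterate_shift)
    moreover have "r = t + of_int (- n)" using n by simp
    ultimately show ?L unfolding suspension_rel_def full_shift_eq topspace_euclidean_subtopology by blast
  qed
  then show ?thesis by (auto simp: suspension_point_def)
qed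

lemma suspension_point_translate:
  assumes "\<omega> \<in> sequences_in A"
  shows "suspension_point A (translate n \<omega>, t) = suspension_point A (\<omega>, t + of_int n)"
proof -
  define F where "F k = (translate k \<omega>, t + of_int n - of_int k)" for k
  have "range (\<lambda>k. k + n) = UNIV" unfolding surj_def by (metis diff_add_cancel)
  then have "range (\<lambda>k. F (k + n)) = range F" by (metis image_image)
  then show ?thesis using assms by (simp add: suspension_point_eq_orbit F_def)
qed

lemma suspension_flow_point:
  assumes "\<omega> \<in> sequences_in A"
  shows "suspension_flow s (suspension_point A (\<omega>, t)) = suspension_point A (\<omega>, s + t)"
  using assms by (simp add: suspension_flow_def suspension_point_eq_orbit image_image algebra_simps)

lemma topspace_suspension:
  "topspace (suspension (full_shift A) shift_map) = suspension_point A ` (sequences_in A \<times> UNIV)"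
  by (auto simp: suspension_def topspace_quotient_topology quotient_def suspension_point_def full_shift_eq)

lemma quotient_map_suspension_point:
  "quotient_map (top_of_set (sequences_in A \<times> UNIV)) (suspension (full_shift A) shift_map) (suspension_point A)"
  unfolding suspension_def suspension_point_def[abs_def] prod_full_shift[symmetric]
  by (rule quotient_map_quotient_topology)

text \<open>
  The lifting condition read on representatives and in the complex unit circle, where the lemmas
  on continuous lifts apply.
\<close>

lemma is_lift_along_flow_iff:
  assumes "\<phi> \<in> topspace (suspension (full_shift A) shift_map) \<rightarrow> topspace RmodZ" "\<omega> \<in> sequences_in A"
  shows "is_lift_along_flow \<phi> (suspension_point A (\<omega>, t\<^sub>0)) g \<longleftrightarrow>
    continuous_on UNIV g \<and> (\<forall>t. cis (2 * pi * g t) = to_circle (\<phi> (suspension_point A (\<omega>, t + t\<^sub>0))))"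
proof -
  have "\<phi> (suspension_point A (\<omega>, t + t\<^sub>0)) \<in> topspace RmodZ" for t
    using assms by (auto simp: topspace_suspension)
  then show ?thesis
    by (simp add: is_lift_along_flow_def suspension_flow_point assms class_eq_iff_to_circle)
qed

lemma continuous_on_to_circle_suspension:
  assumes "continuous_map (suspension (full_shift A) shift_map) RmodZ \<phi>"
  shows "continuous_on (sequences_in A \<times> UNIV) (\<lambda>p. to_circle (\<phi> (suspension_point A p)))"
proof -
  have "continuous_map (top_of_set (sequences_in A \<times> UNIV)) euclidean
      (to_circle \<circ> (\<phi> \<circ> suspension_point A))"
    using assms quotient_map_suspension_point quotient_imp_continuous_map continuous_map_to_circle continuous_map_compose
    by metis
  then show ?thesis by (simp add: o_def)
qed

text \<open>
  Equivariance supplies the return to the fundamental domain: the time \<open>t\<close> is reduced to its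
  fractional part by shifting the sequence \<open>\<lfloor>t\<rfloor>\<close> places, simultaneously for all \<open>s\<close>.
\<close>

lemma equivariant_homotopy_lifts_bounded_distance:
  fixes H :: "real \<times> (int \<Rightarrow> real) \<times> real \<Rightarrow> complex"
  assumes "compact A" "continuous_on ({0..1} \<times> sequences_in A \<times> UNIV) H"
    and "\<And>z. z \<in> {0..1} \<times> sequences_in A \<times> UNIV \<Longrightarrow> norm (H z) = 1"
    and equiv: "\<And>s \<omega> n t. \<lbrakk>s \<in> {0..1}; \<omega> \<in> sequences_in A\<rbrakk> \<Longrightarrow> H (s, translate n \<omega>, t) = H (s, \<omega>, t + of_int n)"
    and "\<omega> \<in> sequences_in A"
    and "continuous_on UNIV g\<^sub>0" "\<And>t. cis (2 * pi * g\<^sub>0 t) = H (0, \<omega>, t)"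
    and "continuous_on UNIV g\<^sub>1" "\<And>t. cis (2 * pi * g\<^sub>1 t) = H (1, \<omega>, t)"
  obtains C where "\<And>t. \<bar>g\<^sub>1 t - g\<^sub>0 t\<bar> \<le> C"
proof (rule homotopic_circle_lifts_bounded_distance[OF compact_sequences_in[OF assms(1)] assms(2,3) _ assms(5-9)])
  fix \<omega> and t :: real assume w: "\<omega> \<in> sequences_in A"
  have "\<forall>s\<in>{0..1}. H (s, \<omega>, t) = H (s, translate \<lfloor>t\<rfloor> \<omega>, frac t)"
    using w by (simp add: equiv frac_def)
  moreover have "frac t \<in> {0..1}" using frac_lt_1[of t] by (simp add: less_imp_le)
  ultimately show "\<exists>v\<in>sequences_in A. \<exists>r\<in>{0..1}. \<forall>s\<in>{0..1}. H (s, \<omega>, t) = H (s, v, r)"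
    using w by (metis translate_in_sequences)
qed auto

section \<open>Rotation numbers and homotopies\<close>

text \<open>
  The slope \<open>m\<close> is the degree of \<open>\<phi>\<close> along the orbit of a constant sequence, which has period one. All
  other orbits are compared with it along the straight-line homotopy of sequences.
\<close>

lemma lifts_along_suspension_flow:
  assumes A: "compact A" "convex A" "A \<noteq> {}"
    and \<phi>: "continuous_map (suspension (full_shift A) shift_map) RmodZ \<phi>"
  shows "\<exists>m\<in>\<int>. \<forall>x\<in>topspace (suspension (full_shift A) shift_map).
    (\<exists>g. is_lift_along_flow \<phi> x g) \<and>
    (\<forall>g. is_lift_along_flow \<phi> x g \<longrightarrow> ((\<lambda>t. g t / t) \<longlongrightarrow> m) at_top)"
proof -
  let ?S = "sequences_in A"
  define \<Phi> where "\<Phi> p = to_circle (\<phi> (suspension_point A p))" for p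
  have \<phi>_into: "\<phi> \<in> topspace (suspension (full_shift A) shift_map) \<rightarrow> topspace RmodZ"
    using \<phi> by (rule continuous_map_funspace)
  have cont: "continuous_on (?S \<times> UNIV) \<Phi>"
    unfolding \<Phi>_def by (rule continuous_on_to_circle_suspension[OF \<phi>])
  have unit: "norm (\<Phi> (\<omega>, t)) = 1" if "\<omega> \<in> ?S" for \<omega> t
    unfolding \<Phi>_def using \<phi>_into that by (intro norm_to_circle) (auto simp: topspace_suspension)
  have equiv: "\<Phi> (translate n \<omega>, t) = \<Phi> (\<omega>, t + of_int n)" if "\<omega> \<in> ?S" for \<omega> t n
    by (simp add: \<Phi>_def suspension_point_translate that)
  have ex: "\<exists>g. continuous_on UNIV g \<and> (\<forall>t. cis (2 * pi * g t) = \<Phi> (\<omega>, t + t\<^sub>0))" if "\<omega> \<in> ?S" for \<omega> t\<^sub>0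
  proof -
    have "continuous_on UNIV (\<lambda>t. \<Phi> (\<omega>, t + t\<^sub>0))"
      using that by (intro continuous_on_compose2[OF cont] continuous_intros) auto
    then show ?thesis
      using circle_lift_on_contractible[of UNIV "\<lambda>t. \<Phi> (\<omega>, t + t\<^sub>0)"] unit[OF that]
      by (metis UNIV_I contractible_UNIV)
  qed
  obtain a where a: "a \<in> A" using A(3) by blast
  define c :: "int \<Rightarrow> real" where "c = (\<lambda>_. a)"
  have c: "c \<in> ?S" "translate n c = c" for n by (auto simp: c_def sequences_in_def a translate_def)
  obtain g\<^sub>0 where g0: "continuous_on UNIV g\<^sub>0" "\<And>t. cis (2 * pi * g\<^sub>0 t) = \<Phi> (c, t)"
    using ex[OF c(1), of 0] by auto
  have "cis (2 * pi * g\<^sub>0 (t + 1)) = cis (2 * pi * g\<^sub>0 t)" for t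
    using equiv[OF c(1), of 1 t] by (simp add: g0 c(2))
  then obtain m C\<^sub>0 where m: "m \<in> \<int>" and C0: "\<And>t. \<bar>g\<^sub>0 t - m * t\<bar> \<le> C\<^sub>0"
    using periodic_circle_lift_linear[OF g0(1)] by metis
  have slope: "((\<lambda>t. g t / t) \<longlongrightarrow> m) at_top"
    if w: "\<omega> \<in> ?S" and g: "continuous_on UNIV g" "\<And>t. cis (2 * pi * g t) = \<Phi> (\<omega>, t + t\<^sub>0)" for \<omega> t\<^sub>0 g
  proof -
    \<comment> \<open>The deformation to the periodic orbit, with time counted from the starting point of the orbit.\<close>
    define H where "H = (\<lambda>(s::real, \<alpha>, t). \<Phi> (\<lambda>n. (1 - s) * a + s * \<alpha> n, t + t\<^sub>0))"
    have mix: "(\<lambda>n. (1 - s) * a + s * \<alpha> n) \<in> ?S" if "s \<in> {0..1}" "\<alpha> \<in> ?S" for s \<alpha>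
      using convexD_alt[OF A(2) a, of _ s] that by (auto simp: sequences_in_def)
    have contH: "continuous_on ({0..1} \<times> ?S \<times> UNIV) H"
      unfolding H_def case_prod_beta
    proof (rule continuous_on_compose2[OF cont])
      have "continuous_on ({0..1} \<times> ?S \<times> UNIV) (\<lambda>z :: real \<times> (int \<Rightarrow> real) \<times> real. fst (snd z) n)" for n
        by (rule continuous_on_product_then_coordinatewise) (intro continuous_intros)
      then show "continuous_on ({0..1} \<times> ?S \<times> UNIV)
          (\<lambda>z. (\<lambda>n. (1 - fst z) * a + fst z * fst (snd z) n, snd (snd z) + t\<^sub>0))"
        by (intro continuous_intros continuous_on_coordinatewise_then_product)
    qed (use mix in auto)
    obtain C\<^sub>1 where C1: "\<And>t. \<bar>g t - g\<^sub>0 (t + t\<^sub>0)\<bar> \<le> C\<^sub>1"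
    proof (rule equivariant_homotopy_lifts_bounded_distance[OF A(1) contH _ _ w, of "\<lambda>t. g\<^sub>0 (t + t\<^sub>0)" g])
      show "norm (H z) = 1" if "z \<in> {0..1} \<times> ?S \<times> UNIV" for z
        using that mix by (auto simp: H_def intro!: unit)
      show "H (s, translate n \<alpha>, t) = H (s, \<alpha>, t + of_int n)" if "s \<in> {0..1}" "\<alpha> \<in> ?S" for s \<alpha> n t
        using equiv[OF mix[OF that], of n "t + t\<^sub>0"] by (simp add: H_def translate_def algebra_simps)
      show "continuous_on UNIV (\<lambda>t. g\<^sub>0 (t + t\<^sub>0))"
        by (intro continuous_on_compose2[OF g0(1)] continuous_intros) auto
      show "cis (2 * pi * g\<^sub>0 (t + t\<^sub>0)) = H (0, \<omega>, t)" for t by (simp add: H_def g0 c_def)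
      show "cis (2 * pi * g t) = H (1, \<omega>, t)" for t by (simp add: H_def g)
    qed (use g in auto)
    have "\<bar>g t - m * t\<bar> \<le> C\<^sub>1 + C\<^sub>0 + \<bar>m * t\<^sub>0\<bar>" for t
      using C1[of t] C0[of "t + t\<^sub>0"] by (simp add: distrib_left)
    then show ?thesis by (rule slope_of_bounded_distance)
  qed
  show ?thesis
  proof (intro bexI[OF _ m] ballI conjI allI impI)
    fix x assume "x \<in> topspace (suspension (full_shift A) shift_map)"
    then obtain \<omega> t\<^sub>0 where x: "\<omega> \<in> ?S" "x = suspension_point A (\<omega>, t\<^sub>0)"
      by (auto simp: topspace_suspension)
    note lift_iff = is_lift_along_flow_iff[OF \<phi>_into x(1), of t\<^sub>0, folded x(2) \<Phi>_def]
    show "\<exists>g. is_lift_along_flow \<phi> x g"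
      using ex[OF x(1)] lift_iff by simp
    show "((\<lambda>t. g t / t) \<longlongrightarrow> m) at_top" if "is_lift_along_flow \<phi> x g" for g
      using that lift_iff slope[OF x(1)] by blast
  qed
qed

text \<open>
  The homotopy is pulled back to representatives, where it is automatically equivariant; by bounded
  distance the slopes on a single orbit already agree.
\<close>

lemma homotopic_imp_rotation_slopes_eq:
  assumes A: "compact A" and hom: "homotopic_with (\<lambda>_. True) (suspension (full_shift A) shift_map) RmodZ \<phi> \<psi>"
    and x: "x \<in> topspace (suspension (full_shift A) shift_map)"
    and g: "is_lift_along_flow \<phi> x g" "((\<lambda>t. g t / t) \<longlongrightarrow> m) at_top"
    and h: "is_lift_along_flow \<psi> x h" "((\<lambda>t. h t / t) \<longlongrightarrow> k) at_top"
  shows "m = k"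
proof -
  let ?X = "suspension (full_shift A) shift_map" and ?S = "sequences_in A"
  obtain \<omega> t\<^sub>0 where w: "\<omega> \<in> ?S" and x_eq: "x = suspension_point A (\<omega>, t\<^sub>0)"
    using x by (auto simp: topspace_suspension)
  obtain G where G: "continuous_map (prod_topology (top_of_set {0..1::real}) ?X) RmodZ G"
      "\<And>x. G (0, x) = \<phi> x" "\<And>x. G (1, x) = \<psi> x"
    using hom unfolding homotopic_with_def by blast
  define H where "H = (\<lambda>(s::real, \<alpha>, t). to_circle (G (s, suspension_point A (\<alpha>, t + t\<^sub>0))))"
  have "continuous_map (top_of_set ({0..1::real} \<times> ?S \<times> UNIV)) (prod_topology (top_of_set {0..1}) ?X)
      (\<lambda>z. (fst z, suspension_point A (fst (snd z), snd (snd z) + t\<^sub>0)))"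
  proof (rule continuous_map_paired[THEN iffD2], intro conjI)
    show "continuous_map (top_of_set ({0..1} \<times> ?S \<times> UNIV)) (top_of_set {0..1}) (\<lambda>z::real \<times> (int \<Rightarrow> real) \<times> real. fst z)"
      by (auto intro!: continuous_intros)
    have "continuous_map (top_of_set ({0..1} \<times> ?S \<times> UNIV)) (top_of_set (?S \<times> UNIV))
        (\<lambda>z::real \<times> (int \<Rightarrow> real) \<times> real. (fst (snd z), snd (snd z) + t\<^sub>0))"
      by (auto intro!: continuous_on_Pair continuous_on_add continuous_on_fst continuous_on_snd
          continuous_on_id continuous_on_const)
    from continuous_map_compose[OF this quotient_imp_continuous_map[OF quotient_map_suspension_point]]
    show "continuous_map (top_of_set ({0..1} \<times> ?S \<times> UNIV)) ?X
        (\<lambda>z::real \<times> (int \<Rightarrow> real) \<times> real. suspension_point A (fst (snd z), snd (snd z) + t\<^sub>0))"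
      by (simp add: o_def)
  qed
  from continuous_map_compose[OF continuous_map_compose[OF this G(1)] continuous_map_to_circle]
  have contH: "continuous_on ({0..1} \<times> ?S \<times> UNIV) H"
    by (simp add: H_def o_def case_prod_beta)
  have G_into: "G (s, suspension_point A (\<alpha>, t)) \<in> topspace RmodZ" if "s \<in> {0..1}" "\<alpha> \<in> ?S" for s \<alpha> t
    using continuous_map_funspace[OF G(1)] that by (auto simp: topspace_suspension Pi_iff)
  have lift_g: "continuous_on UNIV g" "\<And>t. cis (2 * pi * g t) = H (0, \<omega>, t)"
    and lift_h: "continuous_on UNIV h" "\<And>t. cis (2 * pi * h t) = H (1, \<omega>, t)"
    using g(1) h(1) homotopic_with_imp_continuous_maps[OF hom] w
    by (auto simp: H_def G x_eq is_lift_along_flow_iff continuous_map_funspace)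
  obtain C where C: "\<And>t. \<bar>h t - g t\<bar> \<le> C"
  proof (rule equivariant_homotopy_lifts_bounded_distance[OF A contH _ _ w lift_g lift_h])
    show "norm (H z) = 1" if "z \<in> {0..1} \<times> ?S \<times> UNIV" for z
      using that by (auto simp: H_def intro!: norm_to_circle G_into)
    show "H (s, translate n \<alpha>, t) = H (s, \<alpha>, t + of_int n)" if "\<alpha> \<in> ?S" for s \<alpha> n t
      using that by (simp add: H_def suspension_point_translate algebra_simps)
  qed auto
  have "((\<lambda>t. (h t - g t) / t) \<longlongrightarrow> 0) at_top"
    using C by (intro slope_of_bounded_distance[of _ 0 C]) simp
  moreover have "((\<lambda>t. (h t - g t) / t) \<longlongrightarrow> k - m) at_top"
    using tendsto_diff[OF h(2) g(2)] by (simp add: diff_divide_distrib)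
  ultimately have "k - m = 0"
    using tendsto_unique[OF trivial_limit_at_top_linorder] by blast
  then show ?thesis by simp
qed

section \<open>The suspension measure is a probability measure\<close>

text \<open>
  The complement is the union of all open null sets. By the Lindelof property countably many of them
  suffice.
\<close>

lemma emeasure_compl_topological_support:
  fixes M :: "'a::second_countable_topology measure"
  assumes "sets M = sets borel"
  shows "emeasure M (- topological_support M) = 0"
proof -
  let ?N = "{U. open U \<and> emeasure M U = 0}"
  have "- topological_support M = \<Union>?N"
    by (auto simp: topological_support_def zero_less_iff_neq_zero)
  moreover obtain \<F> where \<F>: "\<F> \<subseteq> ?N" "countable \<F>" "\<Union>\<F> = \<Union>?N"
    using Lindelof[of ?N] by blast
  moreover have "\<Union>\<F> \<in> null_sets M"
    using \<F> by (intro null_sets_UN' [where N = "\<lambda>U. U", simplified]) (auto simp: null_sets_def assms)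
  ultimately show ?thesis by (simp add: null_setsD1)
qed

lemma prob_space_restrict_topological_support:
  fixes M :: "'a::second_countable_topology measure"
  assumes "prob_space M" "sets M = sets borel" "closed (topological_support M)"
  shows "prob_space (restrict_space M (topological_support M))"
proof -
  interpret prob_space M by fact
  have sp: "space M = UNIV" using sets_eq_imp_space_eq[OF assms(2)] by simp
  have A: "topological_support M \<in> sets M" using assms by simp
  have "prob (topological_support M) = 1"
    using prob_compl[OF A] emeasure_compl_topological_support[OF assms(2)]
    by (simp add: sp Compl_eq_Diff_UNIV measure_def)
  then show ?thesis
    using A by (intro prob_spaceI) (simp add: emeasure_restrict_space space_restrict_space sp emeasure_eq_measure)
qed

text \<open>
  The preimage of an open set of the suspension is relatively open in the product of the sequence space
  and the line. Second countability puts it into the product \<open>\<sigma>\<close>-algebra.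
  Measurability is what makes the total mass of the image measure equal to one.
\<close>

lemma suspension_point_measurable:
  assumes "sets \<mu>\<^sub>0 = sets borel"
  shows "suspension_point A \<in> (product_shift_measure A \<mu>\<^sub>0 \<Otimes>\<^sub>M restrict_space lborel {0..1}) \<rightarrow>\<^sub>M
      sigma (topspace (suspension (full_shift A) shift_map)) {U. openin (suspension (full_shift A) shift_map) U}"
    (is "_ \<in> ?M \<rightarrow>\<^sub>M sigma (topspace ?X) _")
proof (rule measurable_sigma_sets)
  have sp0: "space \<mu>\<^sub>0 = UNIV" using sets_eq_imp_space_eq[OF assms] by simp
  have space: "space ?M \<subseteq> sequences_in A \<times> UNIV"
    by (auto simp: space_pair_measure product_shift_measure_def space_PiM space_restrict_space sp0
        sequences_in_def PiE_iff)
  show "sets (sigma (topspace ?X) {U. openin ?X U}) = sigma_sets (topspace ?X) {U. openin ?X U}"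
    by (intro sets_measure_of) (auto dest: openin_subset)
  show "{U. openin ?X U} \<subseteq> Pow (topspace ?X)" by (auto dest: openin_subset)
  show "suspension_point A \<in> space ?M \<rightarrow> topspace ?X"
    using space by (auto simp: topspace_suspension)
  fix U assume "U \<in> {U. openin ?X U}"
  then have "openin (top_of_set (sequences_in A \<times> UNIV)) {p \<in> sequences_in A \<times> UNIV. suspension_point A p \<in> U}"
    using quotient_imp_continuous_map[OF quotient_map_suspension_point, of A]
    by (auto simp: continuous_map_def)
  then obtain V :: "((int \<Rightarrow> real) \<times> real) set" where V: "open V"
      "{p \<in> sequences_in A \<times> UNIV. suspension_point A p \<in> U} = sequences_in A \<times> UNIV \<inter> V"
    unfolding openin_open by blast
  have "suspension_point A -` U \<inter> space ?M = (\<lambda>p. p) -` V \<inter> space ?M"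
    using V(2) space by blast
  also have "\<dots> \<in> sets ?M"
  proof (rule measurable_sets)
    have "(\<lambda>p. p) \<in> ?M \<rightarrow>\<^sub>M (PiM UNIV (\<lambda>_. borel) \<Otimes>\<^sub>M borel)"
    proof (rule measurable_Pair[of fst _ _ snd, simplified])
      show "snd \<in> ?M \<rightarrow>\<^sub>M borel"
        by (rule measurable_compose[OF measurable_snd]) (simp add: measurable_restrict_space1)
      have "(\<lambda>p n. fst p n) \<in> ?M \<rightarrow>\<^sub>M (PiM UNIV (\<lambda>_. borel))"
      proof (rule measurable_PiM_single')
        fix n :: int
        have "(\<lambda>x. x) \<in> restrict_space \<mu>\<^sub>0 A \<rightarrow>\<^sub>M borel"
          using assms measurable_ident_sets by (intro measurable_restrict_space1) blast
        then show "(\<lambda>p. fst p n) \<in> ?M \<rightarrow>\<^sub>M borel"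
          unfolding product_shift_measure_def
          by (rule measurable_compose[OF measurable_compose[OF measurable_fst measurable_component_singleton[OF UNIV_I]]])
      qed auto
      then show "fst \<in> ?M \<rightarrow>\<^sub>M (PiM UNIV (\<lambda>_. borel))" by simp
    qed
    moreover have "sets (PiM UNIV (\<lambda>_::int. borel) \<Otimes>\<^sub>M borel) = sets (borel :: ((int \<Rightarrow> real) \<times> real) measure)"
      unfolding borel_prod[symmetric] by (rule sets_pair_measure_cong[OF sets_PiM_equal_borel refl])
    ultimately show "(\<lambda>p. p) \<in> ?M \<rightarrow>\<^sub>M borel"
      using measurable_cong_sets[OF refl] by blast
    show "V \<in> sets borel" using V(1) by simp
  qed
  finally show "suspension_point A -` U \<inter> space ?M \<in> sets ?M" .
qed

lemma prob_space_suspension_measure: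
  assumes "prob_space (restrict_space \<mu>\<^sub>0 A)" "sets \<mu>\<^sub>0 = sets borel"
  shows "prob_space (suspension_measure (full_shift A) shift_map (product_shift_measure A \<mu>\<^sub>0))"
proof -
  interpret P: product_prob_space "\<lambda>_::int. restrict_space \<mu>\<^sub>0 A" UNIV
    by (rule product_prob_spaceI) (rule assms)
  interpret L: prob_space "restrict_space lborel {0..1::real}"
    by (rule prob_spaceI) (simp add: emeasure_restrict_space space_restrict_space)
  interpret Q: pair_prob_space "product_shift_measure A \<mu>\<^sub>0" "restrict_space lborel {0..1::real}"
    unfolding product_shift_measure_def ..
  have quotient: "(\<lambda>p. suspension_rel (full_shift A) shift_map `` {p}) = suspension_point A"
    by (simp add: fun_eq_iff suspension_point_def)
  show ?thesis
    unfolding suspension_measure_def quotient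
    by (intro Q.prob_space_distr suspension_point_measurable assms)
qed

lemma space_suspension_measure:
  "space (suspension_measure \<Omega> T \<mu>) = topspace (suspension \<Omega> T)"
  by (simp add: suspension_measure_def space_measure_of_conv)

section \<open>Uniqueness of the almost sure limit\<close>

text \<open>
  The limit is required of some lift only, almost everywhere; a second candidate is excluded because
  a probability measure has at least one point at which the condition holds, and there every lift has
  slope \<open>m\<close>.
\<close>

lemma rotation_number_eqI:
  assumes "prob_space (suspension_measure \<Omega> T \<mu>)"
    and "\<And>x. x \<in> topspace (suspension \<Omega> T) \<Longrightarrow> \<exists>g. is_lift_along_flow \<phi> x g"
    and slope: "\<And>x g. \<lbrakk>x \<in> topspace (suspension \<Omega> T); is_lift_along_flow \<phi> x g\<rbrakk>
       \<Longrightarrow> ((\<lambda>t. g t / t) \<longlongrightarrow> m) at_top"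
  shows "rotation_number \<Omega> T \<mu> \<phi> = m"
  unfolding rotation_number_def
proof (rule the_equality)
  show "AE x in suspension_measure \<Omega> T \<mu>. \<exists>g. is_lift_along_flow \<phi> x g \<and> ((\<lambda>t. g t / t) \<longlongrightarrow> m) at_top"
    using assms(2,3) by (intro AE_I2) (metis space_suspension_measure)
next
  fix c
  assume AE: "AE x in suspension_measure \<Omega> T \<mu>. \<exists>g. is_lift_along_flow \<phi> x g \<and> ((\<lambda>t. g t / t) \<longlongrightarrow> c) at_top"
  show "c = m"
  proof (rule ccontr)
    assume "c \<noteq> m"
    have "AE x in suspension_measure \<Omega> T \<mu>. False"
      using AE
    proof (rule AE_mp, intro AE_I2 impI)
      fix x assume "x \<in> space (suspension_measure \<Omega> T \<mu>)"
        "\<exists>g. is_lift_along_flow \<phi> x g \<and> ((\<lambda>t. g t / t) \<longlongrightarrow> c) at_top"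
      then show False
        using slope \<open>c \<noteq> m\<close> tendsto_unique[OF trivial_limit_at_top_linorder]
        by (metis space_suspension_measure)
    qed
    then show False using prob_space.AE_False[OF assms(1)] by blast
  qed
qed

section \<open>Realising every integer\<close>

text \<open>
  The map \<open>[\<omega>, t] \<mapsto> k t\<close> modulo the integers. Representatives of one point have times that differ by
  integers, so the union of the classes of \<open>k t\<close> over all of them is a single class; no representative has to be
  chosen.
\<close>

definition winding_map :: "int \<Rightarrow> ((int \<Rightarrow> real) \<times> real) set \<Rightarrow> real set" where
  "winding_map k x = mod_Ints `` ((\<lambda>p. of_int k * snd p) ` x)"

lemma winding_map_point:
  assumes "\<omega> \<in> sequences_in A"
  shows "winding_map k (suspension_point A (\<omega>, t)) = mod_Ints `` {of_int k * t}"
proof -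
  have "mod_Ints `` {of_int k * (t - of_int n)} = mod_Ints `` {of_int k * t}" for n
    by (simp add: mod_Ints_class_eq_iff right_diff_distrib)
  then have "(\<Union>n. mod_Ints `` {of_int k * (t - of_int n)}) = mod_Ints `` {of_int k * t}" by simp
  moreover have "winding_map k (suspension_point A (\<omega>, t)) = mod_Ints `` range (\<lambda>n. of_int k * (t - of_int n))"
    using assms by (simp add: winding_map_def suspension_point_eq_orbit image_image)
  moreover have "\<dots> = (\<Union>n. mod_Ints `` {of_int k * (t - of_int n)})" by blast
  ultimately show ?thesis by simp
qed

lemma continuous_map_winding_map:
  "continuous_map (suspension (full_shift A) shift_map) RmodZ (winding_map k)"
proof (rule continuous_compose_quotient_map[OF quotient_map_suspension_point])
  have linear: "continuous_map (top_of_set (sequences_in A \<times> UNIV)) euclideanreal (\<lambda>p. of_int k * snd p)"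
    by (auto intro!: continuous_intros)
  have "continuous_map (top_of_set (sequences_in A \<times> UNIV)) RmodZ (\<lambda>p. mod_Ints `` {of_int k * snd p})"
    using continuous_map_compose[OF linear quotient_imp_continuous_map[OF quotient_map_quotient_topology]]
    by (simp add: o_def RmodZ_def)
  then show "continuous_map (top_of_set (sequences_in A \<times> UNIV)) RmodZ (winding_map k \<circ> suspension_point A)"
    by (rule continuous_map_eq) (auto simp: winding_map_point)
qed

section \<open>The Schwartzman group\<close>

text \<open>
  Homotopy invariance is tested on the orbit of a constant sequence, where the rotation number is the
  slope of any lift.
\<close>

lemma schwartzman_group_full_shift:
  assumes A: "compact A" "convex A" "A \<noteq> {}"
    and prob: "prob_space (suspension_measure (full_shift A) shift_map \<mu>)"
  shows "schwartzman_group (full_shift A) shift_map \<mu> = \<int>"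
proof -
  let ?X = "suspension (full_shift A) shift_map"
  let ?rot = "rotation_number (full_shift A) shift_map \<mu>"
  let ?hom = "homotopic_with (\<lambda>_. True) ?X RmodZ"
  obtain a where a: "a \<in> A" using A(3) by blast
  let ?w = "\<lambda>_::int. a"
  have w: "?w \<in> sequences_in A" using a by (simp add: sequences_in_def)
  define x where "x = suspension_point A (?w, 0)"
  have x: "x \<in> topspace ?X" using w by (auto simp: x_def topspace_suspension)
  have rot: "?rot \<phi> \<in> \<int> \<and> (\<exists>g. is_lift_along_flow \<phi> x g) \<and>
      (\<forall>g. is_lift_along_flow \<phi> x g \<longrightarrow> ((\<lambda>t. g t / t) \<longlongrightarrow> ?rot \<phi>) at_top)"
    if cont: "continuous_map ?X RmodZ \<phi>" for \<phi>
  proof -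
    obtain m where m: "m \<in> \<int>" "\<And>x. x \<in> topspace ?X \<Longrightarrow> \<exists>g. is_lift_along_flow \<phi> x g"
      "\<And>x g. \<lbrakk>x \<in> topspace ?X; is_lift_along_flow \<phi> x g\<rbrakk> \<Longrightarrow> ((\<lambda>t. g t / t) \<longlongrightarrow> m) at_top"
      using lifts_along_suspension_flow[OF A cont] by blast
    have "?rot \<phi> = m" using prob m(2,3) by (rule rotation_number_eqI)
    then show ?thesis using m x by blast
  qed
  have hom_rot: "?rot \<phi> = ?rot \<psi>" if "?hom \<phi> \<psi>" for \<phi> \<psi>
  proof -
    have cont: "continuous_map ?X RmodZ \<phi>" "continuous_map ?X RmodZ \<psi>"
      using homotopic_with_imp_continuous_maps[OF that] by auto
    obtain g h where gh: "is_lift_along_flow \<phi> x g" "is_lift_along_flow \<psi> x h"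
      using rot[OF cont(1)] rot[OF cont(2)] by blast
    show ?thesis
    proof (rule homotopic_imp_rotation_slopes_eq[OF A(1) that x gh(1) _ gh(2)])
      show "((\<lambda>t. g t / t) \<longlongrightarrow> ?rot \<phi>) at_top" using rot[OF cont(1)] gh(1) by blast
      show "((\<lambda>t. h t / t) \<longlongrightarrow> ?rot \<psi>) at_top" using rot[OF cont(2)] gh(2) by blast
    qed
  qed
  have image: "the_elem (?rot ` Collect (?hom \<phi>)) = ?rot \<phi>" if "continuous_map ?X RmodZ \<phi>" for \<phi>
  proof (rule the_elem_image_unique)
    show "Collect (?hom \<phi>) \<noteq> {}"
      using that homotopic_with_refl[of "\<lambda>_. True" ?X RmodZ \<phi>] by blast
    show "?rot \<psi> = ?rot \<phi>" if "\<psi> \<in> Collect (?hom \<phi>)" for \<psi>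
      using that hom_rot[of \<phi> \<psi>] by simp
  qed
  have group: "schwartzman_group (full_shift A) shift_map \<mu> = ?rot ` {\<phi>. continuous_map ?X RmodZ \<phi>}"
  proof -
    have "homotopy_classes ?X RmodZ = (\<lambda>\<phi>. Collect (?hom \<phi>)) ` {\<phi>. continuous_map ?X RmodZ \<phi>}"
      unfolding homotopy_classes_def quotient_def Image_singleton by auto
    then have "schwartzman_group (full_shift A) shift_map \<mu> =
        (\<lambda>\<phi>. the_elem (?rot ` Collect (?hom \<phi>))) ` {\<phi>. continuous_map ?X RmodZ \<phi>}"
      unfolding schwartzman_group_def schwartzman_hom_def by (simp only: image_image)
    also have "\<dots> = ?rot ` {\<phi>. continuous_map ?X RmodZ \<phi>}"
      by (rule image_cong) (simp_all add: image)
    finally show ?thesis .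
  qed
  have "of_int k \<in> ?rot ` {\<phi>. continuous_map ?X RmodZ \<phi>}" for k
  proof (rule image_eqI[of _ _ "winding_map k"])
    have "is_lift_along_flow (winding_map k) x (\<lambda>t. of_int k * t)"
      using w continuous_map_winding_map[of A k]
      by (auto simp: x_def is_lift_along_flow_iff continuous_map_funspace winding_map_point intro!: continuous_intros)
    then have "((\<lambda>t. of_int k * t / t) \<longlongrightarrow> ?rot (winding_map k)) at_top"
      using rot[OF continuous_map_winding_map] by blast
    moreover have "((\<lambda>t. of_int k * t / t) \<longlongrightarrow> real_of_int k) at_top"
      by (rule slope_of_bounded_distance[of _ _ 0]) simp
    ultimately show "real_of_int k = ?rot (winding_map k)"
      using tendsto_unique[OF trivial_limit_at_top_linorder] by blast
  qed (simp add: continuous_map_winding_map)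
  then have "\<int> \<subseteq> ?rot ` {\<phi>. continuous_map ?X RmodZ \<phi>}" by (metis Ints_cases subsetI)
  moreover have "?rot ` {\<phi>. continuous_map ?X RmodZ \<phi>} \<subseteq> \<int>" using rot by blast
  ultimately show ?thesis unfolding group by (rule equalityI[rotated])
qed

theorem corollary1p4:
  fixes A :: "real set" and \<mu>\<^sub>0 :: "real measure"
  assumes "compact A"
    and "prob_space \<mu>\<^sub>0" and "sets \<mu>\<^sub>0 = sets borel"
    and "topological_support \<mu>\<^sub>0 = A"
    and "connected A"
  shows "schwartzman_group (full_shift A) shift_map (product_shift_measure A \<mu>\<^sub>0) = \<int>"
proof (rule schwartzman_group_full_shift)
  have prob: "prob_space (restrict_space \<mu>\<^sub>0 A)"
    using prob_space_restrict_topological_support[OF assms(2,3)] assms(1,4) compact_imp_closed by blast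
  show "compact A" by fact
  show "convex A" using assms(5) connected_convex_1 by blast
  show "A \<noteq> {}" using prob_space.not_empty[OF prob] by (auto simp: space_restrict_space)
  show "prob_space (suspension_measure (full_shift A) shift_map (product_shift_measure A \<mu>\<^sub>0))"
    using prob assms(3) by (rule prob_space_suspension_measure)
qed

end
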